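(* There is a convex subset $X\subset\mathbb{R}^3$ which is not compactly convex.
   Context: For a topological space $X$, $\exp(X)$ denotes the hyperspace of all non-empty compact subsets of $X$, endowed with the Vietoris topology, whose sub-base consists of the sets $\{K\in\exp(X):K\subset U\}$ and $\{K\in\exp(X):K\cap U\neq\emptyset\}$, where $U$ runs over the open subsets of $X$. For points $x,y$ of a real linear space, $[x,y]=\{(1-t)x+ty:t\in[0,1]\}$. A convex subset $X$ of a linear topological space (with the subspace topology) is called compactly convex if there is a continuous map $\Phi:X\to\exp(X)$ such that $[x,y]\subset\Phi(x)\cup\Phi(y)$ for all $x,y\in X$. *)

theory Defs
  imports "HOL-Analysis.Analysis"
begin

definition hyperspace :: "'a topology \<Rightarrow> 'a set set" where
  "hyperspace X = {K. compactin X K \<and> K \<noteq> {}}"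

definition vietoris :: "'a topology \<Rightarrow> 'a set topology" where
  "vietoris X = topology_generated_by
     ({{K \<in> hyperspace X. K \<subseteq> U} | U. openin X U} \<union>
      {{K \<in> hyperspace X. K \<inter> U \<noteq> {}} | U. openin X U})"

lemma topspace_vietoris [simp]: "topspace (vietoris X) = hyperspace X"
proof
  show "topspace (vietoris X) \<subseteq> hyperspace X"
    unfolding vietoris_def topology_generated_by_topspace by auto
  have "hyperspace X = {K \<in> hyperspace X. K \<subseteq> topspace X}"
    by (auto simp: hyperspace_def dest: compactin_subset_topspace)
  then have "hyperspace X \<in> {{K \<in> hyperspace X. K \<subseteq> U} | U. openin X U}"
    using openin_topspace[of X] by (intro CollectI exI[of _ "topspace X"] conjI)
  then show "hyperspace X \<subseteq> topspace (vietoris X)"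
    unfolding vietoris_def topology_generated_by_topspace by (intro Union_upper UnI1)
qed

(* The compatibility of the linear and the topological structure plays no role in the
   definition itself, so it is not imposed through the sort of 'a. *)
definition compactly_convex :: "'a::{real_vector,topological_space} set \<Rightarrow> bool" where
  "compactly_convex X \<longleftrightarrow> convex X \<and>
     (\<exists>\<Phi>. continuous_map (top_of_set X) (vietoris (top_of_set X)) \<Phi> \<and>
          (\<forall>x\<in>X. \<forall>y\<in>X. closed_segment x y \<subseteq> \<Phi> x \<union> \<Phi> y))"

end

theory Submission
  imports Defs
begin

text \<open>
  Let \<open>X\<close> be the region strictly inside the parabolic cylinder \<open>y = x\<^sup>2\<close> together with, on the
  vertical line of the cylinder over \<open>x = u\<close>, the single point at height \<open>0\<close> if \<open>u\<close> is rational
  and the open half-line of positive heights if \<open>u\<close> is irrational. Strict convexity of the parabola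
  makes \<open>X\<close> convex, whatever convex pieces are chosen on the different vertical lines.

  Suppose \<open>\<Phi>\<close> witnesses compact convexity. Over a rational \<open>q\<close>, the compact value at height \<open>0\<close>
  misses the point at height \<open>c \<in> (0, 1]\<close>, which is not in \<open>X\<close>. By upper semicontinuity, for irrational
  \<open>u\<close> near \<open>q\<close> the values at very small heights over \<open>u\<close> miss the point at height \<open>c\<close>, so this
  point has to lie in the value at height \<open>1\<close> over \<open>u\<close>. Thus the set \<open>E c\<close> of the irrational
  \<open>u\<close> for which that last membership fails has no rational limit point. On the other hand each
  irrational \<open>u\<close> is in some \<open>E (1/(n+1))\<close>: otherwise the compact value at height \<open>1\<close> over \<open>u\<close>
  would contain the limit point at height \<open>0\<close>, which is not in \<open>X\<close>. Hence the irrationals are the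
  union of the countably many closed sets \<open>closure (E (1/(n+1)))\<close>, contrary to Baire's theorem.
\<close>

section \<open>The irrationals are not an F-sigma set\<close>

text \<open>Otherwise the complements of the \<open>C n\<close>, which contain the rationals, and the complements of the
  single rationals would be countably many dense open sets with empty intersection.\<close>

lemma irrationals_not_countable_Union_closed:
  fixes C :: "nat \<Rightarrow> real set"
  assumes "\<And>n. closed (C n)"
  shows "(\<Union>n. C n) \<noteq> - \<rat>"
proof
  assume C: "(\<Union>n. C n) = - \<rat>"
  define \<G> where "\<G> = range (\<lambda>n. - C n) \<union> (\<lambda>q. - {q}) ` \<rat>"
  have "countable \<G>"
    by (simp add: \<G>_def countable_rat)
  moreover have "openin (top_of_set UNIV) T \<and> UNIV \<subseteq> closure T" if T: "T \<in> \<G>" for T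
  proof -
    consider n where "T = - C n" | q where "T = - {q}"
      using T by (auto simp: \<G>_def)
    then show ?thesis
    proof cases
      case 1
      then have "\<rat> \<subseteq> T"
        using C by auto
      then show ?thesis
        using 1 assms closure_mono[of \<rat> T] by (auto simp: Rats_closure_real open_Compl)
    next
      case 2
      then show ?thesis
        by (simp add: closure_complement open_Compl)
    qed
  qed
  ultimately have "UNIV \<subseteq> closure (\<Inter>\<G>)"
    by (intro Baire) auto
  moreover have "\<Inter>\<G> = {}"
  proof -
    have "x \<notin> \<Inter>\<G>" for x
    proof (cases "x \<in> \<rat>")
      case True
      then have "- {x} \<in> \<G>"
        by (simp add: \<G>_def)
      then show ?thesis
        by blast
    next
      case False
      then have "x \<in> (\<Union>n. C n)"
        unfolding C by simp
      then obtain n where "x \<in> C n"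
        by blast
      moreover have "- C n \<in> \<G>"
        by (simp add: \<G>_def)
      ultimately show ?thesis
        by blast
    qed
    then show ?thesis
      by blast
  qed
  ultimately show False
    by simp
qed

section \<open>The convex set\<close>

definition cylinder_point :: "real \<Rightarrow> real \<Rightarrow> real ^ 3" where
  "cylinder_point u h = u *\<^sub>R axis 1 1 + u\<^sup>2 *\<^sub>R axis 2 1 + h *\<^sub>R axis 3 1"

definition rational_cylinder :: "(real ^ 3) set" where
  "rational_cylinder =
     {p. (p $ 1)\<^sup>2 < p $ 2} \<union> (\<lambda>u. cylinder_point u 0) ` \<rat>
       \<union> (\<Union>u \<in> - \<rat>. cylinder_point u ` {0<..})"

lemma cylinder_point_nth [simp]:
  "cylinder_point u h $ 1 = u" "cylinder_point u h $ 2 = u\<^sup>2" "cylinder_point u h $ 3 = h"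
  by (simp_all add: cylinder_point_def axis_def)

lemma tendsto_cylinder_point:
  assumes "(f \<longlongrightarrow> u) F" "(g \<longlongrightarrow> h) F"
  shows "((\<lambda>x. cylinder_point (f x) (g x)) \<longlongrightarrow> cylinder_point u h) F"
  unfolding cylinder_point_def by (intro tendsto_intros assms)

lemma mem_rational_cylinder_iff:
  "p \<in> rational_cylinder \<longleftrightarrow>
     (p $ 1)\<^sup>2 < p $ 2 \<or> (p $ 1)\<^sup>2 = p $ 2 \<and> 0 \<le> p $ 3 \<and> (p $ 3 = 0 \<longleftrightarrow> p $ 1 \<in> \<rat>)"
proof
  assume "p \<in> rational_cylinder"
  then show "(p $ 1)\<^sup>2 < p $ 2 \<or>
      (p $ 1)\<^sup>2 = p $ 2 \<and> 0 \<le> p $ 3 \<and> (p $ 3 = 0 \<longleftrightarrow> p $ 1 \<in> \<rat>)"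
    by (auto simp: rational_cylinder_def)
next
  assume R: "(p $ 1)\<^sup>2 < p $ 2 \<or>
      (p $ 1)\<^sup>2 = p $ 2 \<and> 0 \<le> p $ 3 \<and> (p $ 3 = 0 \<longleftrightarrow> p $ 1 \<in> \<rat>)"
  have p: "cylinder_point (p $ 1) (p $ 3) = p" if "(p $ 1)\<^sup>2 = p $ 2"
    using that by (simp add: vec_eq_iff forall_3)
  consider "(p $ 1)\<^sup>2 < p $ 2" | "(p $ 1)\<^sup>2 = p $ 2" "p $ 1 \<in> \<rat>" "p $ 3 = 0"
    | "(p $ 1)\<^sup>2 = p $ 2" "p $ 1 \<in> - \<rat>" "p $ 3 \<in> {0<..}"
    using R by fastforce
  then show "p \<in> rational_cylinder"
  proof cases
    case 1
    then show ?thesis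
      by (simp add: rational_cylinder_def)
  next
    case 2
    then have "p \<in> (\<lambda>u. cylinder_point u 0) ` \<rat>"
      using p by (metis imageI)
    then show ?thesis
      by (simp add: rational_cylinder_def)
  next
    case 3
    then have "p \<in> (\<Union>u \<in> - \<rat>. cylinder_point u ` {0<..})"
      using p by (metis UN_I imageI)
    then show ?thesis
      by (simp add: rational_cylinder_def)
  qed
qed

lemma cylinder_point_mem_iff:
  "cylinder_point u h \<in> rational_cylinder \<longleftrightarrow> 0 \<le> h \<and> (h = 0 \<longleftrightarrow> u \<in> \<rat>)"
  by (simp add: mem_rational_cylinder_iff)

lemma cylinder_point_mem_closed_segment:
  assumes "a \<le> h" "h \<le> b"
  shows "cylinder_point u h \<in> closed_segment (cylinder_point u a) (cylinder_point u b)"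
proof -
  have "h \<in> closed_segment a b"
    using assms by (simp add: closed_segment_eq_real_ivl)
  then obtain t where t: "0 \<le> t" "t \<le> 1" "h = (1 - t) * a + t * b"
    by (auto simp: closed_segment_def)
  then have "cylinder_point u h = (1 - t) *\<^sub>R cylinder_point u a + t *\<^sub>R cylinder_point u b"
    by (simp add: vec_eq_iff forall_3 algebra_simps)
  with t show ?thesis
    by (auto simp: closed_segment_def)
qed

text \<open>The gap \<open>p $ 2 - (p $ 1)\<^sup>2\<close> is concave in \<open>p\<close>, strictly so in the direction of \<open>p $ 1\<close>. So a
  proper convex combination of points of the set lies on the cylinder only if both points are on
  the same vertical line of it.\<close>

lemma convex_rational_cylinder: "convex rational_cylinder"
  unfolding convex_def
proof (intro ballI allI impI)
  fix p q :: "real ^ 3" and a b :: real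
  assume p: "p \<in> rational_cylinder" and q: "q \<in> rational_cylinder"
    and ab: "0 \<le> a" "0 \<le> b" "a + b = 1"
  define r where "r = a *\<^sub>R p + b *\<^sub>R q"
  have "r \<in> rational_cylinder"
  proof (cases "a = 0 \<or> b = 0")
    case True
    then show ?thesis
      using p q ab by (auto simp: r_def)
  next
    case False
    with ab have pos: "0 < a" "0 < b"
      by auto
    have b: "b = 1 - a"
      using ab by simp
    have gap: "r $ 2 - (r $ 1)\<^sup>2 =
        a * (p $ 2 - (p $ 1)\<^sup>2) + b * (q $ 2 - (q $ 1)\<^sup>2) + a * b * (p $ 1 - q $ 1)\<^sup>2"
      by (simp add: r_def b power2_eq_square algebra_simps)
    have nonneg: "0 \<le> a * (p $ 2 - (p $ 1)\<^sup>2)" "0 \<le> b * (q $ 2 - (q $ 1)\<^sup>2)"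
        "0 \<le> a * b * (p $ 1 - q $ 1)\<^sup>2"
      using p q ab by (auto simp: mem_rational_cylinder_iff)
    show ?thesis
    proof (cases "(r $ 1)\<^sup>2 < r $ 2")
      case True
      then show ?thesis
        by (simp add: mem_rational_cylinder_iff)
    next
      case False
      then have "a * (p $ 2 - (p $ 1)\<^sup>2) = 0" "b * (q $ 2 - (q $ 1)\<^sup>2) = 0"
          "a * b * (p $ 1 - q $ 1)\<^sup>2 = 0"
        using gap nonneg by linarith+
      then have eq: "p $ 2 = (p $ 1)\<^sup>2" "q $ 2 = (q $ 1)\<^sup>2" "p $ 1 = q $ 1"
        using pos by auto
      have r1: "r $ 1 = q $ 1"
        using eq by (simp add: r_def b algebra_simps)
      have r2: "r $ 2 = (r $ 1)\<^sup>2"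
        using gap eq by simp
      have r3: "r $ 3 = a * p $ 3 + b * q $ 3"
        by (simp add: r_def)
      have h: "0 \<le> p $ 3" "0 \<le> q $ 3" "p $ 3 = 0 \<longleftrightarrow> q $ 1 \<in> \<rat>" "q $ 3 = 0 \<longleftrightarrow> q $ 1 \<in> \<rat>"
        using p q eq by (auto simp: mem_rational_cylinder_iff)
      have "0 \<le> r $ 3" "r $ 3 = 0 \<longleftrightarrow> p $ 3 = 0 \<and> q $ 3 = 0"
        using h pos by (auto simp: r3 add_nonneg_eq_0_iff)
      then show ?thesis
        using h r1 r2 by (auto simp: mem_rational_cylinder_iff)
    qed
  qed
  then show "a *\<^sub>R p + b *\<^sub>R q \<in> rational_cylinder"
    by (simp add: r_def)
qed

section \<open>Upper semicontinuity of maps into the hyperspace\<close>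

lemma vietoris_continuous_compact_subset:
  assumes "continuous_map (top_of_set X) (vietoris (top_of_set X)) \<Phi>" "x \<in> X"
  shows "compact (\<Phi> x)" "\<Phi> x \<subseteq> X"
proof -
  have "\<Phi> x \<in> hyperspace (top_of_set X)"
    using continuous_map_funspace[OF assms(1)] assms(2) by auto
  then show "compact (\<Phi> x)" "\<Phi> x \<subseteq> X"
    by (simp_all add: hyperspace_def compactin_subtopology)
qed

text \<open>The upper half of Vietoris continuity: the graph of \<open>\<Phi>\<close> is closed. The point \<open>z\<close> may lie
  outside of \<open>X\<close>; compactness of \<open>\<Phi> x\<close> still separates it from \<open>\<Phi> x\<close> by a closed ball.\<close>

lemma vietoris_continuous_eventually_avoids:
  fixes X :: "'a::metric_space set"
  assumes cont: "continuous_map (top_of_set X) (vietoris (top_of_set X)) \<Phi>"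
    and x: "x \<in> X" and z: "z \<notin> \<Phi> x"
    and f: "(f \<longlongrightarrow> x) F" "eventually (\<lambda>i. f i \<in> X) F" and g: "(g \<longlongrightarrow> z) F"
  shows "eventually (\<lambda>i. g i \<notin> \<Phi> (f i)) F"
proof -
  have val: "\<Phi> y \<in> hyperspace (top_of_set X)" if "y \<in> X" for y
    using continuous_map_funspace[OF cont] that by auto
  have "compact (\<Phi> x)" "\<Phi> x \<subseteq> X"
    using vietoris_continuous_compact_subset[OF cont x] .
  then obtain e where e: "e > 0" "cball z e \<subseteq> - \<Phi> x"
    using z open_contains_cball[of "- \<Phi> x"]
    by (metis ComplI compact_imp_closed open_Compl)
  define U where "U = X - cball z e"
  have U: "openin (top_of_set X) U"
    unfolding U_def Diff_eq by (intro openin_open_Int) (simp add: open_Compl)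
  have "openin (vietoris (top_of_set X)) {K \<in> hyperspace (top_of_set X). K \<subseteq> U}"
    unfolding vietoris_def openin_topology_generated_by_iff
    using U by (intro generate_topology_on.Basis) auto
  then have "openin (top_of_set X) {y \<in> X. \<Phi> y \<in> {K \<in> hyperspace (top_of_set X). K \<subseteq> U}}"
    using openin_continuous_map_preimage[OF cont] by fastforce
  then obtain W where W: "open W"
      "{y \<in> X. \<Phi> y \<in> {K \<in> hyperspace (top_of_set X). K \<subseteq> U}} = X \<inter> W"
    by (auto simp: openin_open)
  have "\<Phi> x \<subseteq> U"
    using e \<open>\<Phi> x \<subseteq> X\<close> by (auto simp: U_def)
  then have "x \<in> W"
    using W x val[OF x] by blast
  then have "eventually (\<lambda>i. f i \<in> W) F"
    using f(1) W(1) by (simp add: topological_tendstoD)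
  moreover have "eventually (\<lambda>i. g i \<in> ball z e) F"
    using topological_tendstoD[OF g open_ball] e(1) by simp
  ultimately show ?thesis
    using f(2)
  proof eventually_elim
    case (elim i)
    then have "\<Phi> (f i) \<subseteq> U"
      using W(2) by blast
    moreover have "g i \<notin> U"
      using elim by (auto simp: U_def)
    ultimately show ?case
      by blast
  qed
qed

section \<open>Failure of compact convexity\<close>

lemma not_compactly_convex_rational_cylinder: "\<not> compactly_convex rational_cylinder"
proof
  let ?X = rational_cylinder
  assume "compactly_convex ?X"
  then obtain \<Phi> where cont: "continuous_map (top_of_set ?X) (vietoris (top_of_set ?X)) \<Phi>"
    and seg: "\<And>x y. x \<in> ?X \<Longrightarrow> y \<in> ?X \<Longrightarrow> closed_segment x y \<subseteq> \<Phi> x \<union> \<Phi> y"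
    unfolding compactly_convex_def by blast
  note val = vietoris_continuous_compact_subset[OF cont]
  define E where "E c = {u. u \<notin> \<rat> \<and> cylinder_point u c \<notin> \<Phi> (cylinder_point u 1)}" for c
  have no_rational_limit: "q \<notin> closure (E c)" if "q \<in> \<rat>" "0 < c" "c \<le> 1" for q c
  proof
    assume "q \<in> closure (E c)"
    then obtain u where u: "\<And>n. u n \<in> E c" "u \<longlonglongrightarrow> q"
      by (auto simp: closure_sequential)
    have q0: "cylinder_point q 0 \<in> ?X" and "cylinder_point q c \<notin> ?X"
      using that by (auto simp: cylinder_point_mem_iff)
    then have "cylinder_point q c \<notin> \<Phi> (cylinder_point q 0)"
      using val(2) by blast
    \<comment> \<open>Heights in \<open>(0, c]\<close> that tend to \<open>0\<close>: the segment from height \<open>t n\<close> to height \<open>1\<close>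
      over \<open>u n\<close> then passes through height \<open>c\<close>.\<close>
    define t where "t n = c / real (Suc n)" for n
    have t: "0 < t n" "t n \<le> c" for n
      using that by (auto simp: t_def field_simps)
    have "t \<longlonglongrightarrow> 0"
      unfolding t_def using tendsto_mult[OF tendsto_const[of c] LIMSEQ_inverse_real_of_nat]
      by (simp add: divide_inverse)
    have mem: "cylinder_point (u n) (t n) \<in> ?X" "cylinder_point (u n) 1 \<in> ?X" for n
      using u(1)[of n] t(1)[of n] by (auto simp: E_def cylinder_point_mem_iff)
    have "eventually (\<lambda>n. cylinder_point (u n) c \<notin> \<Phi> (cylinder_point (u n) (t n))) sequentially"
      using cont q0 \<open>cylinder_point q c \<notin> \<Phi> (cylinder_point q 0)\<close>
      by (rule vietoris_continuous_eventually_avoids)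
        (use mem in \<open>auto intro: tendsto_cylinder_point[OF u(2) \<open>t \<longlonglongrightarrow> 0\<close>]
            tendsto_cylinder_point[OF u(2) tendsto_const]\<close>)
    then obtain n where "cylinder_point (u n) c \<notin> \<Phi> (cylinder_point (u n) (t n))"
      by (auto simp: eventually_sequentially)
    moreover have "cylinder_point (u n) c \<in>
        closed_segment (cylinder_point (u n) (t n)) (cylinder_point (u n) 1)"
      using t that by (intro cylinder_point_mem_closed_segment) auto
    ultimately have "cylinder_point (u n) c \<in> \<Phi> (cylinder_point (u n) 1)"
      using seg[OF mem] by blast
    then show False
      using u(1)[of n] by (simp add: E_def)
  qed
  have exhaust: "\<exists>n. u \<in> E (inverse (real (Suc n)))" if "u \<notin> \<rat>" for u
  proof (rule ccontr)
    let ?K = "\<Phi> (cylinder_point u 1)"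
    have u1: "cylinder_point u 1 \<in> ?X"
      using that by (simp add: cylinder_point_mem_iff)
    assume "\<nexists>n. u \<in> E (inverse (real (Suc n)))"
    then have "\<And>n. cylinder_point u (inverse (real (Suc n))) \<in> ?K"
      using that by (auto simp: E_def)
    moreover have "(\<lambda>n. cylinder_point u (inverse (real (Suc n)))) \<longlonglongrightarrow> cylinder_point u 0"
      by (intro tendsto_cylinder_point tendsto_const LIMSEQ_inverse_real_of_nat)
    ultimately have "cylinder_point u 0 \<in> ?K"
      by (rule closed_sequentially[OF compact_imp_closed[OF val(1)[OF u1]]])
    then have "cylinder_point u 0 \<in> ?X"
      using val(2)[OF u1] by blast
    then show False
      using that by (simp add: cylinder_point_mem_iff)
  qed
  define C where "C n = closure (E (inverse (real (Suc n))))" for n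
  have "(\<Union>n. C n) = - \<rat>"
  proof
    show "(\<Union>n. C n) \<subseteq> - \<rat>"
    proof
      fix q
      assume "q \<in> (\<Union>n. C n)"
      then obtain n where "q \<in> closure (E (inverse (real (Suc n))))"
        by (auto simp: C_def)
      moreover have "0 < inverse (real (Suc n))" "inverse (real (Suc n)) \<le> 1"
        by (simp_all add: inverse_le_1_iff)
      ultimately show "q \<in> - \<rat>"
        using no_rational_limit by (metis ComplI)
    qed
    show "- \<rat> \<subseteq> (\<Union>n. C n)"
    proof
      fix u :: real
      assume "u \<in> - \<rat>"
      then obtain n where "u \<in> E (inverse (real (Suc n)))"
        using exhaust by (meson ComplD)
      then have "u \<in> C n"
        unfolding C_def by (rule subsetD[OF closure_subset])
      then show "u \<in> (\<Union>n. C n)"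
        by blast
    qed
  qed
  moreover have "closed (C n)" for n
    by (simp add: C_def)
  ultimately show False
    using irrationals_not_countable_Union_closed by metis
qed

theorem mainTheorem2:
  shows "\<exists>X :: (real ^ 3) set. convex X \<and> \<not> compactly_convex X"
  using convex_rational_cylinder not_compactly_convex_rational_cylinder by blast

end
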